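(* For every quasi-metric space $X, d$, the quasi-metric space $\mathbf B (X, d), d^+$ is Lipschitz regular. For every $d^+$-Scott open subset $U$ of $\mathbf B (X, d)$, $\widehat U = \mu_X^{-1} (U)$.
   Context: A quasi-metric on $X$ is a map $d \colon X \times X \to [0,+\infty]$ with $d(x,x)=0$, the triangle inequality, and $d(x,y)=d(y,x)=0 \Rightarrow x=y$. Formal balls on $X,d$ are pairs $(x,r)$, $x\in X$, $r\in [0,+\infty)$, ordered by $(x,r) \leq^{d^+} (y,s)$ iff $d(x,y) \leq r-s$; they form the poset $\mathbf{B}(X,d)$, with its Scott topology. The $d$-Scott topology on $X$ is the coarsest one making $x \mapsto (x,0) \in \mathbf{B}(X,d)$ continuous, and $X$ is viewed as a subspace of $\mathbf{B}(X,d)$ through that map. $\mathbf{B}(X,d)$ is itself a quasi-metric space with $d^+((x,r),(y,s)) = \max(d(x,y)-r+s,0)$. For a quasi-metric space $Y,\partial$ and a $\partial$-Scott open subset $U$ of $Y$, $\widehat U$ denotes the largest Scott-open subset of $\mathbf{B}(Y,\partial)$ such that $\widehat U \cap Y \subseteq U$ (then $\widehat U \cap Y = U$). $Y,\partial$ is Lipschitz regular iff the map $U \mapsto \widehat U$, from the lattice of open subsets of $Y$ to the lattice of open subsets of $\mathbf{B}(Y,\partial)$ (both ordered by inclusion), is Scott-continuous. The map $\mu_X \colon \mathbf{B}(\mathbf{B}(X,d),d^+) \to \mathbf{B}(X,d)$ is defined by $\mu_X((x,r),s) = (x,r+s)$. *)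

theory Defs
  imports "HOL-Analysis.Abstract_Topology" "HOL-Library.Extended_Real" "HOL-Algebra.Order"
begin

text \<open>
  Spaces are given by an explicit (possibly empty) carrier set; distances take values in
  \<^typ>\<open>ereal\<close> and are constrained only on the carrier.
\<close>

definition quasi_metric_on :: "'a set \<Rightarrow> ('a \<Rightarrow> 'a \<Rightarrow> ereal) \<Rightarrow> bool" where
  "quasi_metric_on X d \<longleftrightarrow>
     (\<forall>x\<in>X. \<forall>y\<in>X. 0 \<le> d x y) \<and>
     (\<forall>x\<in>X. d x x = 0) \<and>
     (\<forall>x\<in>X. \<forall>y\<in>X. \<forall>z\<in>X. d x z \<le> d x y + d y z) \<and>
     (\<forall>x\<in>X. \<forall>y\<in>X. d x y = 0 \<and> d y x = 0 \<longrightarrow> x = y)"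

subsection \<open>Scott topology and Scott continuity\<close>

definition directed_in :: "('a, 'c) gorder_scheme \<Rightarrow> 'a set \<Rightarrow> bool" where
  "directed_in P D \<longleftrightarrow>
     D \<subseteq> carrier P \<and> D \<noteq> {} \<and>
     (\<forall>x\<in>D. \<forall>y\<in>D. \<exists>z\<in>D. x \<sqsubseteq>\<^bsub>P\<^esub> z \<and> y \<sqsubseteq>\<^bsub>P\<^esub> z)"

definition scott_open :: "('a, 'c) gorder_scheme \<Rightarrow> 'a set \<Rightarrow> bool" where
  "scott_open P U \<longleftrightarrow>
     U \<subseteq> carrier P \<and>
     (\<forall>x\<in>U. \<forall>y\<in>carrier P. x \<sqsubseteq>\<^bsub>P\<^esub> y \<longrightarrow> y \<in> U) \<and>
     (\<forall>D s. directed_in P D \<and> is_lub P s D \<and> s \<in> U \<longrightarrow> D \<inter> U \<noteq> {})"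

definition scott_topology :: "('a, 'c) gorder_scheme \<Rightarrow> 'a topology" where
  "scott_topology P = topology (scott_open P)"

lemma istopology_scott_open: "istopology (scott_open P)"
  unfolding istopology_def
proof (intro conjI allI impI)
  fix S T assume S: "scott_open P S" and T: "scott_open P T"
  show "scott_open P (S \<inter> T)"
    unfolding scott_open_def
  proof (intro conjI ballI allI impI)
    show "S \<inter> T \<subseteq> carrier P" using S by (auto simp: scott_open_def)
  next
    fix x y assume "x \<in> S \<inter> T" "y \<in> carrier P" "x \<sqsubseteq>\<^bsub>P\<^esub> y"
    then show "y \<in> S \<inter> T" using S T by (auto simp: scott_open_def)
  next
    fix D s assume a: "directed_in P D \<and> is_lub P s D \<and> s \<in> S \<inter> T"
    then obtain x y where "x \<in> D" "x \<in> S" "y \<in> D" "y \<in> T"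
      using S T unfolding scott_open_def by blast
    moreover from this a obtain z where "z \<in> D" "x \<sqsubseteq>\<^bsub>P\<^esub> z" "y \<sqsubseteq>\<^bsub>P\<^esub> z"
      unfolding directed_in_def by blast
    moreover from this a have "z \<in> carrier P" by (auto simp: directed_in_def)
    ultimately have "z \<in> D \<inter> (S \<inter> T)" using S T unfolding scott_open_def by blast
    then show "D \<inter> (S \<inter> T) \<noteq> {}" by blast
  qed
next
  fix \<K> assume "\<forall>K\<in>\<K>. scott_open P K"
  then have K: "scott_open P K" if "K \<in> \<K>" for K using that by blast
  show "scott_open P (\<Union>\<K>)"
    unfolding scott_open_def
  proof (intro conjI ballI allI impI)
    show "\<Union>\<K> \<subseteq> carrier P" using K unfolding scott_open_def by blast
  next
    fix x y assume "x \<in> \<Union>\<K>" and y: "y \<in> carrier P" "x \<sqsubseteq>\<^bsub>P\<^esub> y"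
    then obtain K where "K \<in> \<K>" "x \<in> K" by blast
    with y K[of K] show "y \<in> \<Union>\<K>" unfolding scott_open_def by blast
  next
    fix D s assume a: "directed_in P D \<and> is_lub P s D \<and> s \<in> \<Union>\<K>"
    then obtain K where *: "K \<in> \<K>" "s \<in> K" by blast
    then have "D \<inter> K \<noteq> {}" using a K[of K] unfolding scott_open_def by fast
    then show "D \<inter> \<Union>\<K> \<noteq> {}" using * by blast
  qed
qed

lemma openin_scott_topology [simp]: "openin (scott_topology P) U \<longleftrightarrow> scott_open P U"
  by (simp add: scott_topology_def istopology_scott_open topology_inverse')

definition scott_continuous ::
  "('a, 'c) gorder_scheme \<Rightarrow> ('b, 'e) gorder_scheme \<Rightarrow> ('a \<Rightarrow> 'b) \<Rightarrow> bool" where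
  "scott_continuous P Q f \<longleftrightarrow>
     f ` carrier P \<subseteq> carrier Q \<and> isotone P Q f \<and>
     (\<forall>D s. directed_in P D \<and> is_lub P s D \<longrightarrow> is_lub Q (f s) (f ` D))"

definition open_lattice :: "'a topology \<Rightarrow> 'a set gorder" where
  "open_lattice T = \<lparr> carrier = {U. openin T U}, eq = (=), le = (\<subseteq>) \<rparr>"

subsection \<open>Formal balls\<close>

definition formal_balls :: "'a set \<Rightarrow> ('a \<times> real) set" where
  "formal_balls X = X \<times> {0..}"

text \<open>
  The radii are subtracted in \<^typ>\<open>real\<close>: the order forces \<open>s \<le> r\<close>, since distances are
  nonnegative.
\<close>

definition ball_le :: "('a \<Rightarrow> 'a \<Rightarrow> ereal) \<Rightarrow> 'a \<times> real \<Rightarrow> 'a \<times> real \<Rightarrow> bool" where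
  "ball_le d = (\<lambda>(x, r) (y, s). d x y \<le> ereal (r - s))"

definition ball_poset :: "'a set \<Rightarrow> ('a \<Rightarrow> 'a \<Rightarrow> ereal) \<Rightarrow> ('a \<times> real) gorder" where
  "ball_poset X d = \<lparr> carrier = formal_balls X, eq = (=), le = ball_le d \<rparr>"

definition ball_dist :: "('a \<Rightarrow> 'a \<Rightarrow> ereal) \<Rightarrow> 'a \<times> real \<Rightarrow> 'a \<times> real \<Rightarrow> ereal" where
  "ball_dist d = (\<lambda>(x, r) (y, s). max (d x y - ereal r + ereal s) 0)"

definition ball_embed :: "'a \<Rightarrow> 'a \<times> real" where
  "ball_embed x = (x, 0)"

definition ball_mult :: "('a \<times> real) \<times> real \<Rightarrow> 'a \<times> real" where
  "ball_mult = (\<lambda>((x, r), s). (x, r + s))"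

lemma quasi_metric_on_ball_dist:
  assumes "quasi_metric_on X d"
  shows "quasi_metric_on (formal_balls X) (ball_dist d)"
proof -
  have nn: "0 \<le> d x y" if "x \<in> X" "y \<in> X" for x y
    using assms that by (auto simp: quasi_metric_on_def)
  have refl: "d x x = 0" if "x \<in> X" for x
    using assms that by (auto simp: quasi_metric_on_def)
  have tri: "d x z \<le> d x y + d y z" if "x \<in> X" "y \<in> X" "z \<in> X" for x y z
    using assms that by (auto simp: quasi_metric_on_def)
  have sep: "x = y" if "x \<in> X" "y \<in> X" "d x y = 0" "d y x = 0" for x y
    using assms that by (auto simp: quasi_metric_on_def)
  have 1: "max (d x z - ereal r + ereal t) 0 \<le>
        max (d x y - ereal r + ereal s) 0 + max (d y z - ereal s + ereal t) 0"
    if "x \<in> X" "y \<in> X" "z \<in> X" for x y z r s t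
    using nn[of x y] nn[of y z] nn[of x z] tri[of x y z] that
    by (cases "d x y"; cases "d y z"; cases "d x z") (auto simp: max_def)
  have 2: "x = y \<and> r = s"
    if "x \<in> X" "y \<in> X" "max (d x y - ereal r + ereal s) 0 = 0"
       "max (d y x - ereal s + ereal r) 0 = 0" for x y r s
  proof -
    have "d x y = 0 \<and> d y x = 0 \<and> r = s"
      using nn[of x y] nn[of y x] that
      by (cases "d x y"; cases "d y x") (auto simp: max_def split: if_splits)
    then show ?thesis using sep that by auto
  qed
  show ?thesis
    using 1 2 refl unfolding quasi_metric_on_def formal_balls_def ball_dist_def
    by auto
qed

lemma partial_order_ball_poset:
  assumes "quasi_metric_on X d"
  shows "partial_order (ball_poset X d)"
proof -
  have nn: "0 \<le> d x y" if "x \<in> X" "y \<in> X" for x y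
    using assms that by (auto simp: quasi_metric_on_def)
  have tri: "d x z \<le> d x y + d y z" if "x \<in> X" "y \<in> X" "z \<in> X" for x y z
    using assms that by (auto simp: quasi_metric_on_def)
  have sep: "x = y" if "x \<in> X" "y \<in> X" "d x y = 0" "d y x = 0" for x y
    using assms that by (auto simp: quasi_metric_on_def)
  have 1: "d x z \<le> ereal (r - t)"
    if "x \<in> X" "y \<in> X" "z \<in> X" "d x y \<le> ereal (r - s)" "d y z \<le> ereal (s - t)" for x y z r s t
    using nn[of x y] nn[of y z] nn[of x z] tri[of x y z] that
    by (cases "d x y"; cases "d y z"; cases "d x z") auto
  have 2: "x = y \<and> r = s"
    if "x \<in> X" "y \<in> X" "d x y \<le> ereal (r - s)" "d y x \<le> ereal (s - r)" for x y r s
  proof -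
    have "d x y = 0 \<and> d y x = 0 \<and> r = s"
      using nn[of x y] nn[of y x] that
      by (cases "d x y"; cases "d y x") auto
    then show ?thesis using sep that by auto
  qed
  have 3: "d x x \<le> ereal 0" if "x \<in> X" for x
    using assms that by (auto simp: quasi_metric_on_def)
  show ?thesis
  proof
    fix u v w
    assume "u \<in> carrier (ball_poset X d)" "v \<in> carrier (ball_poset X d)" "w \<in> carrier (ball_poset X d)"
      "u \<sqsubseteq>\<^bsub>ball_poset X d\<^esub> v" "v \<sqsubseteq>\<^bsub>ball_poset X d\<^esub> w"
    then show "u \<sqsubseteq>\<^bsub>ball_poset X d\<^esub> w"
      using 1[of "fst u" "fst v" "fst w" "snd u" "snd v" "snd w"]
      by (auto simp: ball_poset_def formal_balls_def ball_le_def)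
  next
    fix u v
    assume "u \<sqsubseteq>\<^bsub>ball_poset X d\<^esub> v" "v \<sqsubseteq>\<^bsub>ball_poset X d\<^esub> u"
      "u \<in> carrier (ball_poset X d)" "v \<in> carrier (ball_poset X d)"
    then show "u .=\<^bsub>ball_poset X d\<^esub> v"
      using 2[of "fst u" "fst v" "snd u" "snd v"]
      by (auto simp: ball_poset_def formal_balls_def ball_le_def)
  next
    fix u assume "u \<in> carrier (ball_poset X d)"
    then show "u \<sqsubseteq>\<^bsub>ball_poset X d\<^esub> u"
      using 3[of "fst u"] by (auto simp: ball_poset_def formal_balls_def ball_le_def)
  qed (auto simp: ball_poset_def)
qed

text \<open>
  The initial topology of the map \<open>x \<mapsto> (x, 0)\<close>, that is, the coarsest topology making it continuous.
\<close>

definition d_scott_topology :: "'a set \<Rightarrow> ('a \<Rightarrow> 'a \<Rightarrow> ereal) \<Rightarrow> 'a topology" where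
  "d_scott_topology X d = pullback_topology X ball_embed (scott_topology (ball_poset X d))"

subsection \<open>Lipschitz regularity\<close>

definition hat :: "'a set \<Rightarrow> ('a \<Rightarrow> 'a \<Rightarrow> ereal) \<Rightarrow> 'a set \<Rightarrow> ('a \<times> real) set" where
  "hat Y d U =
     (GREATEST V. openin (scott_topology (ball_poset Y d)) V \<and> ball_embed -` V \<inter> Y \<subseteq> U)"

lemma hat_eq_Union:
  "hat Y d U = \<Union>{V. openin (scott_topology (ball_poset Y d)) V \<and> ball_embed -` V \<inter> Y \<subseteq> U}"
  unfolding hat_def
proof (rule Greatest_equality)
  show "openin (scott_topology (ball_poset Y d))
      (\<Union>{V. openin (scott_topology (ball_poset Y d)) V \<and> ball_embed -` V \<inter> Y \<subseteq> U}) \<and>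
    ball_embed -` (\<Union>{V. openin (scott_topology (ball_poset Y d)) V \<and> ball_embed -` V \<inter> Y \<subseteq> U}) \<inter> Y
      \<subseteq> U"
    by (intro conjI openin_Union) auto
qed blast

definition lipschitz_regular :: "'a set \<Rightarrow> ('a \<Rightarrow> 'a \<Rightarrow> ereal) \<Rightarrow> bool" where
  "lipschitz_regular Y d \<longleftrightarrow>
     quasi_metric_on Y d \<and>
     scott_continuous (open_lattice (d_scott_topology Y d))
       (open_lattice (scott_topology (ball_poset Y d))) (hat Y d)"

end

(*
Both the unit x \<mapsto> (x, 0), from B(X,d) to B(B(X,d), d+), and the multiplication \<mu> are Scott-continuous.
For the unit, an upper bound of elements of radius 0 again has radius 0. For \<mu>, if (y, t) bounds
the images of a directed family with supremum ((x, r), s), then ((y, t - s'), s') with s' = min s t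
bounds the family itself. Hence the d+-Scott open sets U of B(X,d) are Scott open, and so are the
sets \<mu>^-1(U). The latter are largest possible because ((x, r), s) lies below ((x, r + s), 0). Finally,
taking preimages under \<mu> commutes with unions.
*)
theory Submission
  imports Defs
begin

lemma directed_in_image:
  assumes "isotone P Q f" "f ` carrier P \<subseteq> carrier Q" "directed_in P D"
  shows "directed_in Q (f ` D)"
  unfolding directed_in_def
proof (intro conjI ballI)
  have D: "D \<subseteq> carrier P" "D \<noteq> {}" using assms(3) by (auto simp: directed_in_def)
  show "f ` D \<subseteq> carrier Q" "f ` D \<noteq> {}" using D assms(2) by auto
  fix u v assume "u \<in> f ` D" "v \<in> f ` D"
  then obtain x y where xy: "x \<in> D" "u = f x" "y \<in> D" "v = f y" by blast
  then obtain z where "z \<in> D" "x \<sqsubseteq>\<^bsub>P\<^esub> z" "y \<sqsubseteq>\<^bsub>P\<^esub> z"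
    using assms(3) unfolding directed_in_def by blast
  then show "\<exists>w\<in>f ` D. u \<sqsubseteq>\<^bsub>Q\<^esub> w \<and> v \<sqsubseteq>\<^bsub>Q\<^esub> w"
    using use_iso2[OF assms(1)] xy D by (metis imageI subsetD)
qed

text \<open>The image of a directed family is directed with supremum \<open>f s\<close>, so Scott
  openness of \<open>U\<close> catches some \<open>f x\<close> with \<open>x\<close> in the family.
  This transports openness along both the unit and the multiplication.\<close>

lemma scott_open_vimage:
  assumes f: "scott_continuous P Q f" and U: "scott_open Q U"
  shows "scott_open P (f -` U \<inter> carrier P)"
  unfolding scott_open_def
proof (intro conjI ballI allI impI)
  have iso: "isotone P Q f" and car: "f ` carrier P \<subseteq> carrier Q"
    using f by (auto simp: scott_continuous_def)
  fix x y assume *: "x \<in> f -` U \<inter> carrier P" "y \<in> carrier P" "x \<sqsubseteq>\<^bsub>P\<^esub> y"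
  then have "f x \<sqsubseteq>\<^bsub>Q\<^esub> f y" using use_iso2[OF iso] by blast
  then show "y \<in> f -` U \<inter> carrier P"
    using * U car unfolding scott_open_def by blast
next
  fix D s assume *: "directed_in P D \<and> is_lub P s D \<and> s \<in> f -` U \<inter> carrier P"
  then have "is_lub Q (f s) (f ` D)" using f by (auto simp: scott_continuous_def)
  moreover have "directed_in Q (f ` D)"
    using f * by (intro directed_in_image[of P]) (auto simp: scott_continuous_def)
  ultimately have "f ` D \<inter> U \<noteq> {}" using U * by (auto simp: scott_open_def)
  moreover have "D \<subseteq> carrier P" using * by (simp add: directed_in_def)
  ultimately show "D \<inter> (f -` U \<inter> carrier P) \<noteq> {}" by blast
qed auto

lemma is_lub_carrier: "is_lub P s D \<Longrightarrow> s \<in> carrier P"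
  by (auto simp: least_def Upper_def)

lemma is_lub_upper: "is_lub P s D \<Longrightarrow> D \<subseteq> carrier P \<Longrightarrow> x \<in> D \<Longrightarrow> x \<sqsubseteq>\<^bsub>P\<^esub> s"
  by (auto simp: least_def Upper_def)

lemma is_lub_least:
  "is_lub P s D \<Longrightarrow> u \<in> carrier P \<Longrightarrow> (\<And>x. x \<in> D \<Longrightarrow> x \<sqsubseteq>\<^bsub>P\<^esub> u) \<Longrightarrow> s \<sqsubseteq>\<^bsub>P\<^esub> u"
  by (auto simp: least_def Upper_def)

text \<open>Monotonicity already makes \<open>f s\<close> an upper bound of the image of
  \<open>D\<close>, so the only real work is to place \<open>f s\<close> below every other upper
  bound \<open>u\<close>.\<close>

lemma scott_continuousI:
  assumes "partial_order P" "partial_order Q"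
    and car: "\<And>x. x \<in> carrier P \<Longrightarrow> f x \<in> carrier Q"
    and mono: "\<And>x y. x \<in> carrier P \<Longrightarrow> y \<in> carrier P \<Longrightarrow> x \<sqsubseteq>\<^bsub>P\<^esub> y \<Longrightarrow> f x \<sqsubseteq>\<^bsub>Q\<^esub> f y"
    and least: "\<And>D s u. directed_in P D \<Longrightarrow> is_lub P s D \<Longrightarrow> u \<in> carrier Q \<Longrightarrow>
      (\<And>x. x \<in> D \<Longrightarrow> f x \<sqsubseteq>\<^bsub>Q\<^esub> u) \<Longrightarrow> f s \<sqsubseteq>\<^bsub>Q\<^esub> u"
  shows "scott_continuous P Q f"
  unfolding scott_continuous_def
proof (intro conjI allI impI)
  show "f ` carrier P \<subseteq> carrier Q" using car by blast
  show "isotone P Q f"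
    using assms(1,2) mono by (auto intro!: isotoneI partial_order.axioms)
  fix D s assume *: "directed_in P D \<and> is_lub P s D"
  then have D: "D \<subseteq> carrier P" by (simp add: directed_in_def)
  have fD: "f ` D \<subseteq> carrier Q" using D car by blast
  have s: "s \<in> carrier P" using is_lub_carrier[OF conjunct2[OF *]] .
  have "f x \<sqsubseteq>\<^bsub>Q\<^esub> f s" if "x \<in> D" for x
    using mono[OF subsetD[OF D that] s is_lub_upper[OF conjunct2[OF *] D that]] .
  moreover have "f s \<sqsubseteq>\<^bsub>Q\<^esub> u" if "u \<in> Upper Q (f ` D)" for u
    using that least[of D s u] * fD by (auto simp: Upper_def)
  ultimately show "is_lub Q (f s) (f ` D)"
    using car[OF s] by (auto simp: least_def Upper_def)
qed

text \<open>A maximum with 0 is at most \<open>s - s'\<close> iff both arguments are: the 0 gives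
  \<open>s' \<le> s\<close>, and the distance term rearranges to the comparison of the two images
  under \<open>ball_mult\<close>. All later order arguments on balls of balls rest on this
  splitting.\<close>

lemma ball_le_ball_dist:
  "ball_le (ball_dist d) ((x, r), s) ((y, r'), s') \<longleftrightarrow> s' \<le> s \<and> ball_le d (x, r + s) (y, r' + s')"
  by (cases "d x y") (auto simp: ball_le_def ball_dist_def)

lemma scott_continuous_ball_embed:
  assumes "quasi_metric_on X d"
  shows "scott_continuous (ball_poset X d) (ball_poset (formal_balls X) (ball_dist d)) ball_embed"
    (is "scott_continuous ?P ?Q _")
proof (rule scott_continuousI)
  show "partial_order ?P" "partial_order ?Q"
    using assms by (auto intro: partial_order_ball_poset quasi_metric_on_ball_dist)
next
  fix u assume "u \<in> carrier ?P"
  then show "ball_embed u \<in> carrier ?Q" by (simp add: ball_poset_def formal_balls_def ball_embed_def)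
next
  fix u v assume "u \<in> carrier ?P" "v \<in> carrier ?P" "u \<sqsubseteq>\<^bsub>?P\<^esub> v"
  then show "ball_embed u \<sqsubseteq>\<^bsub>?Q\<^esub> ball_embed v"
    by (cases u; cases v) (simp add: ball_poset_def ball_embed_def ball_le_ball_dist)
next
  fix D a u
  assume D: "directed_in ?P D" and lub: "is_lub ?P a D" and u: "u \<in> carrier ?Q"
    and ub: "\<And>x. x \<in> D \<Longrightarrow> ball_embed x \<sqsubseteq>\<^bsub>?Q\<^esub> u"
  obtain y t s where u_eq: "u = ((y, t), s)" by (metis surj_pair)
  have s0: "s \<ge> 0" and yt: "(y, t) \<in> carrier ?P"
    using u u_eq by (auto simp: ball_poset_def formal_balls_def)
  obtain v where "v \<in> D" using D by (auto simp: directed_in_def)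
  \<comment> \<open>\<open>ball_embed v\<close> has outer radius 0, and outer radii decrease along
    the order.\<close>
  then have s: "s = 0"
    using ub[of v] s0 by (cases v) (auto simp: ball_poset_def ball_embed_def u_eq ball_le_ball_dist)
  have "x \<sqsubseteq>\<^bsub>?P\<^esub> (y, t)" if "x \<in> D" for x
    using ub[OF that] s
    by (cases x) (auto simp: ball_poset_def ball_embed_def u_eq ball_le_ball_dist)
  then have "a \<sqsubseteq>\<^bsub>?P\<^esub> (y, t)" using is_lub_least[OF lub yt] by blast
  then show "ball_embed a \<sqsubseteq>\<^bsub>?Q\<^esub> u"
    using s by (cases a) (auto simp: ball_poset_def ball_embed_def u_eq ball_le_ball_dist)
qed

lemma scott_continuous_ball_mult:
  assumes "quasi_metric_on X d"
  shows "scott_continuous (ball_poset (formal_balls X) (ball_dist d)) (ball_poset X d) ball_mult"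
    (is "scott_continuous ?Q ?P _")
proof (rule scott_continuousI)
  show "partial_order ?P" "partial_order ?Q"
    using assms by (auto intro: partial_order_ball_poset quasi_metric_on_ball_dist)
next
  fix u assume "u \<in> carrier ?Q"
  then show "ball_mult u \<in> carrier ?P" by (auto simp: ball_poset_def formal_balls_def ball_mult_def)
next
  fix u v assume "u \<in> carrier ?Q" "v \<in> carrier ?Q" "u \<sqsubseteq>\<^bsub>?Q\<^esub> v"
  then show "ball_mult u \<sqsubseteq>\<^bsub>?P\<^esub> ball_mult v"
    by (cases u; cases v; cases "fst u"; cases "fst v")
      (auto simp: ball_poset_def ball_mult_def ball_le_ball_dist)
next
  fix D a u
  assume D: "directed_in ?Q D" and lub: "is_lub ?Q a D" and u: "u \<in> carrier ?P"
    and ub: "\<And>x. x \<in> D \<Longrightarrow> ball_mult x \<sqsubseteq>\<^bsub>?P\<^esub> u"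
  obtain y t where u_eq: "u = (y, t)" by (metis surj_pair)
  obtain x r s where a_eq: "a = ((x, r), s)" by (metis surj_pair)
  have D_car: "D \<subseteq> carrier ?Q" using D by (simp add: directed_in_def)
  have s0: "s \<ge> 0" using is_lub_carrier[OF lub] a_eq by (auto simp: ball_poset_def formal_balls_def)
  \<comment> \<open>The bound by \<open>t\<close> keeps the inner radius \<open>t - s'\<close>
    nonnegative. The bound by \<open>s\<close> keeps \<open>s'\<close> below the outer radius of
    each \<open>b\<close> in \<open>D\<close>, since \<open>b\<close> lies below \<open>a\<close>.
    The split is chosen so that \<open>ball_mult w = u\<close>.\<close>
  define s' where "s' = min s t"
  define w where "w = ((y, t - s'), s')"
  have "w \<in> carrier ?Q"
    using u u_eq s0 by (auto simp: w_def s'_def ball_poset_def formal_balls_def)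
  moreover have "b \<sqsubseteq>\<^bsub>?Q\<^esub> w" if "b \<in> D" for b
    using ub[OF that] is_lub_upper[OF lub D_car that]
    by (cases b; cases "fst b")
      (auto simp: ball_poset_def ball_mult_def w_def s'_def a_eq u_eq ball_le_ball_dist)
  ultimately have "a \<sqsubseteq>\<^bsub>?Q\<^esub> w" using is_lub_least[OF lub] by blast
  then show "ball_mult a \<sqsubseteq>\<^bsub>?P\<^esub> u"
    by (simp add: ball_poset_def ball_mult_def w_def a_eq u_eq ball_le_ball_dist)
qed

lemma hat_formal_balls:
  assumes qm: "quasi_metric_on X d"
    and U: "openin (d_scott_topology (formal_balls X) (ball_dist d)) U"
  shows "hat (formal_balls X) (ball_dist d) U = {b \<in> formal_balls (formal_balls X). ball_mult b \<in> U}"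
proof -
  let ?P = "ball_poset X d" and ?Q = "ball_poset (formal_balls X) (ball_dist d)"
  let ?M = "{b \<in> formal_balls (formal_balls X). ball_mult b \<in> U}"
  have carP: "carrier ?P = formal_balls X" and carQ: "carrier ?Q = formal_balls (formal_balls X)"
    by (simp_all add: ball_poset_def)
  \<comment> \<open>An open set of the pullback topology is the preimage of a Scott-open set under
    \<open>ball_embed\<close>.\<close>
  obtain V where V: "scott_open ?Q V" "U = ball_embed -` V \<inter> carrier ?P"
    using U by (auto simp: d_scott_topology_def openin_pullback_topology carP)
  have "scott_open ?P U"
    using scott_open_vimage[OF scott_continuous_ball_embed[OF qm] V(1)] V(2) by simp
  then have "scott_open ?Q (ball_mult -` U \<inter> carrier ?Q)"
    by (rule scott_open_vimage[OF scott_continuous_ball_mult[OF qm]])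
  then have M: "scott_open ?Q ?M"
    by (simp add: carQ vimage_def Int_def conj_commute)
  \<comment> \<open>\<open>ball_mult\<close> is a left inverse of \<open>ball_embed\<close>.\<close>
  have M_le: "ball_embed -` ?M \<inter> formal_balls X \<subseteq> U"
    by (auto simp: ball_embed_def ball_mult_def)
  have largest: "W \<subseteq> ?M"
    if W: "scott_open ?Q W" "ball_embed -` W \<inter> formal_balls X \<subseteq> U" for W
  proof
    fix b assume b: "b \<in> W"
    then have b_car: "b \<in> formal_balls (formal_balls X)"
      using W(1) carQ unfolding scott_open_def by blast
    obtain x r s where b_eq: "b = ((x, r), s)" by (metis surj_pair)
    have x: "x \<in> X" and rs: "r \<ge> 0" "s \<ge> 0" using b_car b_eq by (auto simp: formal_balls_def)
    then have mem: "(x, r + s) \<in> formal_balls X" by (simp add: formal_balls_def)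
    have "ball_le d (x, r + s) (x, r + s)"
      using x qm by (simp add: ball_le_def quasi_metric_on_def)
    \<comment> \<open>Both sides have the same image under \<open>ball_mult\<close>, and the outer
      radius drops from \<open>s\<close> to 0. As \<open>W\<close> is upward closed, it contains the
      right-hand side, whose trace condition then yields \<open>ball_mult b \<in> U\<close>.\<close>
    then have "b \<sqsubseteq>\<^bsub>?Q\<^esub> ball_embed (x, r + s)"
      using rs by (simp add: ball_poset_def b_eq ball_embed_def ball_le_ball_dist)
    moreover have "ball_embed (x, r + s) \<in> carrier ?Q"
      using mem by (simp add: ball_embed_def ball_poset_def formal_balls_def)
    ultimately have "ball_embed (x, r + s) \<in> W"
      using W(1) b unfolding scott_open_def by blast
    then show "b \<in> ?M" using W(2) mem b_car by (auto simp: b_eq ball_mult_def)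
  qed
  show ?thesis
    unfolding hat_eq_Union using M M_le largest by (intro equalityI Union_least Union_upper) auto
qed

lemma partial_order_open_lattice: "partial_order (open_lattice T)"
  by unfold_locales (auto simp: open_lattice_def)

text \<open>The union is itself open, hence an upper bound inside the lattice, and the supremum
  cannot exceed it.\<close>

lemma is_lub_open_lattice_eq_Union:
  assumes "\<And>U. U \<in> D \<Longrightarrow> openin T U" and lub: "is_lub (open_lattice T) S D"
  shows "S = \<Union>D"
proof
  show "\<Union>D \<subseteq> S"
    using is_lub_upper[OF lub] assms(1) by (auto simp: open_lattice_def)
  have "openin T (\<Union>D)" using assms(1) by blast
  then show "S \<subseteq> \<Union>D"
    using is_lub_least[OF lub, of "\<Union>D"] by (auto simp: open_lattice_def)
qed

theorem theorem4p10:
  fixes X :: "'a set" and d :: "'a \<Rightarrow> 'a \<Rightarrow> ereal"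
  assumes "quasi_metric_on X d"
  shows "lipschitz_regular (formal_balls X) (ball_dist d) \<and>
    (\<forall>U. openin (d_scott_topology (formal_balls X) (ball_dist d)) U \<longrightarrow>
      hat (formal_balls X) (ball_dist d) U = {b \<in> formal_balls (formal_balls X). ball_mult b \<in> U})"
proof -
  let ?T = "d_scott_topology (formal_balls X) (ball_dist d)"
  let ?Q = "scott_topology (ball_poset (formal_balls X) (ball_dist d))"
  let ?hat = "hat (formal_balls X) (ball_dist d)"
  note hat_eq = hat_formal_balls[OF assms]
  have "scott_continuous (open_lattice ?T) (open_lattice ?Q) ?hat"
  proof (rule scott_continuousI[OF partial_order_open_lattice partial_order_open_lattice])
    fix U
    show "?hat U \<in> carrier (open_lattice ?Q)"
      \<comment> \<open>The simp rule is removed so that the goal keeps the form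
        \<open>openin\<close>, to which \<open>openin_Union\<close> applies.\<close>
      unfolding hat_eq_Union open_lattice_def by (simp del: openin_scott_topology) (intro openin_Union, auto)
  next
    fix U V
    assume "U \<in> carrier (open_lattice ?T)" "V \<in> carrier (open_lattice ?T)" "U \<sqsubseteq>\<^bsub>open_lattice ?T\<^esub> V"
    then show "?hat U \<sqsubseteq>\<^bsub>open_lattice ?Q\<^esub> ?hat V"
      by (auto simp: open_lattice_def hat_eq)
  next
    fix D S W
    assume D: "directed_in (open_lattice ?T) D" and lub: "is_lub (open_lattice ?T) S D"
      and ub: "\<And>U. U \<in> D \<Longrightarrow> ?hat U \<sqsubseteq>\<^bsub>open_lattice ?Q\<^esub> W"
    have D_open: "openin ?T U" if "U \<in> D" for U
      using D that by (auto simp: directed_in_def open_lattice_def)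
    have "openin ?T S" using is_lub_carrier[OF lub] by (simp add: open_lattice_def)
    moreover have "S = \<Union>D" using is_lub_open_lattice_eq_Union[OF D_open lub] .
    \<comment> \<open>If \<open>ball_mult b\<close> lies in the union of \<open>D\<close>, it lies
      in some \<open>U\<close> of \<open>D\<close>, so \<open>b\<close> belongs to
      \<open>?hat U\<close>, which is contained in \<open>W\<close>.\<close>
    ultimately show "?hat S \<sqsubseteq>\<^bsub>open_lattice ?Q\<^esub> W"
      using ub D_open by (fastforce simp: open_lattice_def hat_eq)
  qed
  then show ?thesis
    using hat_eq quasi_metric_on_ball_dist[OF assms] by (simp add: lipschitz_regular_def)
qed

end
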